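(* Assume $\mu>0$ and that $h$ satisfies the assumption stated in the context. There exist unique constants $A^*,B^*,d^*,u^*$ such that $g(x)=g_{A^*,B^*}(x)$, $d^*$ and $u^*$ satisfy $$g(d^* )=-k,\qquad g(u^* )=\ell,\qquad g'(d^* )=0,\qquad g'(u^* )=0.$$ Furthermore, $g$ decreases on $(-\infty,d^* )$, increases on $(d^*,u^* )$, and decreases again on $(u^*,\infty)$.
   Context: $\mu>0$, $\sigma>0$, $k>0$, $\ell>0$ are constants and $\lambda=2\mu/\sigma^2>0$. Assumption on $h:\mathbb R\to[0,\infty)$: $h$ is continuous and convex; there is $a\in\mathbb R$ such that $h$ is $C^2$ on $\mathbb R\setminus\{a\}$ and $h(a)=0$; $h'(x)<0$ for $x<a$ and $h'(x)>0$ for $x>a$; and $\int_{-\infty}^a|h'(y)|e^{\lambda(y-a)}dy<\infty$. For $A,B,x\in\mathbb R$, $$g_{A,B}(x)=A-Be^{-\lambda(x-a)}-\frac{\lambda}{\mu}\int_a^x h(y)e^{-\lambda(x-y)}\,dy.$$ *)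

theory Defs
  imports "HOL-Analysis.Analysis"
begin

text \<open>Intended for open S, so that the derivatives at points of S do not depend on the
  values of f or f' outside S.\<close>
definition C2_on :: "real set \<Rightarrow> (real \<Rightarrow> real) \<Rightarrow> bool" where
  "C2_on S f \<longleftrightarrow>
     (\<exists>f' f''. (\<forall>x\<in>S. (f has_real_derivative f' x) (at x)) \<and>
               (\<forall>x\<in>S. (f' has_real_derivative f'' x) (at x)) \<and>
               continuous_on S f'')"

text \<open>h need not be differentiable at a. The integrand below is then unspecified at the
  single point a, which does not affect its integrability.\<close>
definition holding_cost :: "real \<Rightarrow> real \<Rightarrow> (real \<Rightarrow> real) \<Rightarrow> bool" where
  "holding_cost lam a h \<longleftrightarrow>
     (\<forall>x. 0 \<le> h x) \<and>
     continuous_on UNIV h \<and>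
     convex_on UNIV h \<and>
     C2_on (UNIV - {a}) h \<and>
     h a = 0 \<and>
     (\<forall>x<a. deriv h x < 0) \<and>
     (\<forall>x>a. deriv h x > 0) \<and>
     set_integrable lborel {..a} (\<lambda>y. \<bar>deriv h y\<bar> * exp (lam * (y - a)))"

text \<open>The interval integral is oriented: for x < a it is minus the integral from x to a.\<close>
definition g_AB ::
  "real \<Rightarrow> real \<Rightarrow> real \<Rightarrow> (real \<Rightarrow> real) \<Rightarrow> real \<Rightarrow> real \<Rightarrow> real \<Rightarrow> real" where
  "g_AB mu lam a h A B x =
     A - B * exp (- lam * (x - a))
       - lam / mu * (LBINT y=ereal a..ereal x. h y * exp (- lam * (x - y)))"

definition boundary_conditions ::
  "real \<Rightarrow> real \<Rightarrow> (real \<Rightarrow> real) \<Rightarrow> real \<Rightarrow> real \<Rightarrow> bool" where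
  "boundary_conditions k l g d u \<longleftrightarrow>
     g d = - k \<and> g u = l \<and>
     (g has_real_derivative 0) (at d) \<and> (g has_real_derivative 0) (at u)"

end

theory Submission
  imports Defs
begin

text \<open>
  Put \<open>E x = exp (lam * (x - a))\<close> and let \<open>H x\<close> be the integral of \<open>h' E\<close> from \<open>a\<close> to \<open>x\<close>.
  Integration by parts turns the derivative of \<open>g\<close> into
  \<open>lam / E x * (B - H x / mu)\<close>, so the shape of \<open>g\<close> is decided by where \<open>H\<close> lies above or below the
  level \<open>mu * B\<close>. Since \<open>h'\<close> is negative left of \<open>a\<close> and positive right of it, \<open>H\<close> is a valley with
  bottom \<open>H a = 0\<close>: it takes each positive value at most once on either side of \<open>a\<close>, and \<open>g\<close>
  decreases, increases and decreases again, turning at the two solutions of \<open>H x = mu * B\<close>.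

  At a critical point \<open>g x = A - h x / mu\<close>. Hence the boundary conditions say exactly that
  \<open>H d = H u = mu * B\<close>, that \<open>h d - h u = mu * (k + l)\<close>, and that \<open>A = h d / mu - k\<close>, and the problem
  is to find \<open>d\<close> and \<open>u\<close>. What settles it is that \<open>D = h - H\<close>, whose derivative is
  \<open>h' (1 - E)\<close>, is strictly decreasing on the whole line, because the two factors
  change sign together at \<open>a\<close>. On the level set \<open>H d = H u\<close> the remaining equation reads
  \<open>D d - D u = mu * (k + l)\<close>. This forces \<open>d < a < u\<close>. Moving \<open>d\<close> to the left raises the level and
  pushes \<open>u\<close> to the right, and both movements increase \<open>D d - D u\<close>; so there is at most one solution.
  As \<open>d\<close> runs from \<open>a\<close> to minus infinity, \<open>D d - D u\<close> runs continuously from 0 to infinity, because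
  convexity makes \<open>h\<close>, and with it \<open>D\<close>, grow at least linearly to the left; so there is a solution.
\<close>

section \<open>The exponentially weighted cost\<close>

definition weighted_integral :: "real \<Rightarrow> real \<Rightarrow> (real \<Rightarrow> real) \<Rightarrow> real \<Rightarrow> real" where
  "weighted_integral lam a h x = (LBINT y=ereal a..ereal x. h y * exp (lam * (y - a)))"

text \<open>This is the integral of \<open>h' y * exp (lam * (y - a))\<close> over \<open>y\<close> from \<open>a\<close> to \<open>x\<close>, integrated by
  parts so that \<open>h\<close> may have a kink at \<open>a\<close>.\<close>
definition slope_integral :: "real \<Rightarrow> real \<Rightarrow> (real \<Rightarrow> real) \<Rightarrow> real \<Rightarrow> real" where
  "slope_integral lam a h x = h x * exp (lam * (x - a)) - lam * weighted_integral lam a h x"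

lemma weighted_integral_at_base [simp]: "weighted_integral lam a h a = 0"
  by (simp add: weighted_integral_def)

lemma weighted_integral_has_derivative:
  assumes "continuous_on UNIV h"
  shows "(weighted_integral lam a h has_real_derivative h x * exp (lam * (x - a))) (at x)"
proof -
  let ?f = "\<lambda>y. h y * exp (lam * (y - a))"
  define p where "p = min a x - 1"
  define q where "q = max a x + 1"
  have pq: "p < x" "x < q" "p \<le> a" "a \<le> q"
    by (auto simp: p_def q_def)
  have "continuous_on {p..q} ?f"
    by (intro continuous_intros continuous_on_subset[OF assms]) auto
  from interval_integral_FTC2[OF pq(3,4) this, of x] pq
  have "((\<lambda>u. LBINT y=a..u. ?f y) has_vector_derivative ?f x) (at x within {p..q})"
    by simp
  moreover have "at x within {p..q} = at x"
    using pq by (intro at_within_interior) (simp add: interior_cbox)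
  ultimately show ?thesis
    unfolding weighted_integral_def[abs_def] has_real_derivative_iff_has_vector_derivative by simp
qed

lemma continuous_weighted_integral:
  assumes "continuous_on UNIV h"
  shows "continuous_on S (weighted_integral lam a h)"
  by (meson DERIV_isCont assms continuous_at_imp_continuous_on weighted_integral_has_derivative)

text \<open>Splitting the kernel as \<open>exp (- lam * (x - a)) * exp (lam * (y - a))\<close> takes the dependence on
  \<open>x\<close> out of the integral.\<close>
lemma g_AB_eq:
  "g_AB mu lam a h A B x =
     A - exp (- lam * (x - a)) * (B + lam / mu * weighted_integral lam a h x)"
proof -
  have kernel: "h y * exp (- lam * (x - y)) = exp (- lam * (x - a)) * (h y * exp (lam * (y - a)))"
    for y
    by (simp add: algebra_simps flip: exp_add)
  have "(LBINT y=ereal a..ereal x. h y * exp (- lam * (x - y)))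
          = exp (- lam * (x - a)) * weighted_integral lam a h x"
    unfolding kernel weighted_integral_def by simp
  then show ?thesis
    by (simp add: g_AB_def algebra_simps)
qed

lemma g_AB_has_derivative:
  assumes "continuous_on UNIV h"
  shows "(g_AB mu lam a h A B has_real_derivative
           lam * exp (- lam * (x - a)) * (B - slope_integral lam a h x / mu)) (at x)"
proof -
  have "((\<lambda>x. A - exp (- lam * (x - a)) * (B + lam / mu * weighted_integral lam a h x))
          has_real_derivative
           lam * exp (- lam * (x - a)) * (B - slope_integral lam a h x / mu)) (at x)"
    by (rule derivative_eq_intros weighted_integral_has_derivative[OF assms] refl)+
       (simp add: slope_integral_def algebra_simps add_divide_distrib diff_divide_distrib)
  then show ?thesis
    by (simp only: g_AB_eq[abs_def])
qed

lemma g_AB_critical_iff: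
  assumes "continuous_on UNIV h" "lam > 0" "mu > 0"
  shows "(g_AB mu lam a h A B has_real_derivative 0) (at x) \<longleftrightarrow> slope_integral lam a h x = mu * B"
proof -
  let ?g' = "lam * exp (- lam * (x - a)) * (B - slope_integral lam a h x / mu)"
  have "(g_AB mu lam a h A B has_real_derivative 0) (at x) \<longleftrightarrow> ?g' = 0"
    using g_AB_has_derivative[OF assms(1)] DERIV_unique by metis
  also have "\<dots> \<longleftrightarrow> slope_integral lam a h x = mu * B"
    using assms by (auto simp: field_simps)
  finally show ?thesis .
qed

lemma g_AB_at_critical:
  assumes "mu > 0" "slope_integral lam a h x = mu * B"
  shows "g_AB mu lam a h A B x = A - h x / mu"
proof -
  have "mu * (B + lam / mu * weighted_integral lam a h x) = h x * exp (lam * (x - a))"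
    using assms by (simp add: slope_integral_def algebra_simps)
  then have "B + lam / mu * weighted_integral lam a h x = h x / mu * exp (lam * (x - a))"
    using assms(1) by (metis less_irrefl nonzero_mult_div_cancel_left times_divide_eq_left)
  then have "exp (- lam * (x - a)) * (B + lam / mu * weighted_integral lam a h x)
      = h x / mu * (exp (- lam * (x - a)) * exp (lam * (x - a)))"
    by simp
  then show ?thesis
    by (simp add: g_AB_eq flip: exp_add)
qed

text \<open>The boundary conditions separate: \<open>B\<close> is the common level of the slope integral, \<open>A\<close> follows
  from the value at \<open>d\<close>, and what is left is a pair of equations for \<open>d\<close> and \<open>u\<close>.\<close>
lemma boundary_conditions_iff:
  assumes "continuous_on UNIV h" "lam > 0" "mu > 0"
  shows "boundary_conditions k l (g_AB mu lam a h A B) d u \<longleftrightarrow>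
           slope_integral lam a h d = slope_integral lam a h u \<and>
           h d - h u = mu * (k + l) \<and>
           B = slope_integral lam a h d / mu \<and> A = h d / mu - k"
    (is "?bc \<longleftrightarrow> ?eqs")
proof -
  have "?bc \<longleftrightarrow> slope_integral lam a h d = mu * B \<and> slope_integral lam a h u = mu * B \<and>
          A - h d / mu = - k \<and> A - h u / mu = l"
    unfolding boundary_conditions_def g_AB_critical_iff[OF assms]
    using g_AB_at_critical[OF assms(3)] by (metis (no_types, lifting))
  also have "\<dots> \<longleftrightarrow> ?eqs"
    using assms(3) by (auto simp: field_simps)
  finally show ?thesis .
qed

section \<open>Monotonicity and growth\<close>

locale convex_cost =
  fixes lam a :: real and h :: "real \<Rightarrow> real"
  assumes lam_pos: "lam > 0" and cost: "holding_cost lam a h"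
begin

abbreviation H :: "real \<Rightarrow> real" where "H \<equiv> slope_integral lam a h"
abbreviation D :: "real \<Rightarrow> real" where "D x \<equiv> h x - H x"

lemma cont_h: "continuous_on S h"
  using cost continuous_on_subset unfolding holding_cost_def by blast

lemma h_nonneg: "h x \<ge> 0"
  using cost by (simp add: holding_cost_def)

lemma h_base [simp]: "h a = 0"
  using cost by (simp add: holding_cost_def)

lemma H_base [simp]: "H a = 0"
  by (simp add: slope_integral_def)

lemma deriv_h_neg: "x < a \<Longrightarrow> deriv h x < 0"
  and deriv_h_pos: "x > a \<Longrightarrow> deriv h x > 0"
  using cost by (auto simp: holding_cost_def)

lemma h_has_derivative: "x \<noteq> a \<Longrightarrow> (h has_real_derivative deriv h x) (at x)"
  using cost DERIV_imp_deriv unfolding holding_cost_def C2_on_def by fastforce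

lemma h_above_tangent:
  assumes "x \<noteq> a"
  shows "h y \<ge> h x + deriv h x * (y - x)"
proof -
  have "h y - h x \<ge> deriv h x * (y - x)"
    using cost h_has_derivative[OF assms] unfolding holding_cost_def
    by (intro convex_on_imp_above_tangent[where A = UNIV]) auto
  then show ?thesis
    by simp
qed

lemma cont_H: "continuous_on S H"
  unfolding slope_integral_def[abs_def]
  by (intro continuous_intros cont_h continuous_weighted_integral)

lemma H_has_derivative:
  assumes "x \<noteq> a"
  shows "(H has_real_derivative deriv h x * exp (lam * (x - a))) (at x)"
  unfolding slope_integral_def[abs_def]
  by (rule derivative_eq_intros h_has_derivative[OF assms]
        weighted_integral_has_derivative[OF cont_h] refl)+ (simp add: algebra_simps)

lemma D_has_derivative:
  assumes "x \<noteq> a"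
  shows "(D has_real_derivative deriv h x * (1 - exp (lam * (x - a)))) (at x)"
  by (rule derivative_eq_intros h_has_derivative[OF assms] H_has_derivative[OF assms] refl)+
     (simp add: algebra_simps)

lemma H_increasing: "H x < H y" if "a \<le> x" "x < y"
proof (rule DERIV_pos_imp_increasing_open[OF that(2)])
  show "\<exists>r. DERIV H z :> r \<and> r > 0" if "x < z" "z < y" for z
    using H_has_derivative[of z] deriv_h_pos[of z] \<open>a \<le> x\<close> that by fastforce
qed (rule cont_H)

lemma H_decreasing: "H y < H x" if "y \<le> a" "x < y"
proof (rule DERIV_neg_imp_decreasing_open[OF that(2)])
  show "\<exists>r. DERIV H z :> r \<and> r < 0" if "x < z" "z < y" for z
    using H_has_derivative[of z] deriv_h_neg[of z] \<open>y \<le> a\<close> that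
    by (intro exI[of _ "deriv h z * exp (lam * (z - a))"]) (auto simp: mult_less_0_iff)
qed (rule cont_H)

text \<open>The slope \<open>h'\<close> and the factor \<open>1 - exp (lam * (x - a))\<close> have opposite signs on both sides
  of \<open>a\<close>, which gives the strict decrease on either side; the pieces meet at \<open>a\<close>.\<close>
lemma D_decreasing: "D y < D x" if "x < y"
proof -
  have off_base: "D y < D x" if xy: "x < y" and side: "y \<le> a \<or> a \<le> x" for x y
  proof (rule DERIV_neg_imp_decreasing_open[OF xy])
    fix z assume z: "x < z" "z < y"
    then consider "z < a" | "a < z"
      using side by linarith
    then have "deriv h z * (1 - exp (lam * (z - a))) < 0"
      using deriv_h_neg[of z] deriv_h_pos[of z] lam_pos
      by cases (auto simp: mult_less_0_iff)
    then show "\<exists>r. DERIV D z :> r \<and> r < 0"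
      using D_has_derivative[of z] z side by fastforce
  qed (intro continuous_intros cont_h cont_H)
  show ?thesis
    using off_base[of x y] off_base[of x a] off_base[of a y] that by fastforce
qed

text \<open>To the right of \<open>a\<close> the weight is at least 1, so \<open>H\<close> dominates \<open>h\<close>, which lies above an
  increasing tangent.\<close>
lemma H_unbounded_right: "\<exists>b\<ge>a. H b \<ge> c"
proof -
  define s where "s = deriv h (a + 1)"
  have s: "s > 0"
    using deriv_h_pos[of "a + 1"] by (simp add: s_def)
  define b where "b = a + 1 + \<bar>c\<bar> / s"
  have b: "a < b"
    using s by (simp add: b_def add_pos_nonneg)
  have "\<bar>c\<bar> = s * (b - (a + 1))"
    using s by (simp add: b_def)
  also have "\<dots> \<le> h b"
    using h_above_tangent[of "a + 1" b] h_nonneg[of "a + 1"] by (simp add: s_def)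
  also have "\<dots> \<le> H b"
    using D_decreasing[OF b] by simp
  finally show ?thesis
    using b by (intro exI[of _ b]) auto
qed

text \<open>To the left of \<open>a - 1\<close> the factor \<open>1 - exp (lam * (x - a))\<close> is at least
  \<open>q = 1 - exp (- lam)\<close>, so \<open>D\<close> grows there at least as fast as \<open>q * h\<close>, and \<open>h\<close> lies above a
  decreasing tangent.\<close>
lemma D_unbounded_left: "\<exists>d<a. D d \<ge> c"
proof -
  define q where "q = 1 - exp (- lam)"
  have q: "q > 0"
    using lam_pos by (simp add: q_def)
  define s where "s = - deriv h (a - 1)"
  have s: "s > 0"
    using deriv_h_neg[of "a - 1"] by (simp add: s_def)
  define d where "d = a - 1 - \<bar>c\<bar> / (q * s)"
  have d: "d \<le> a - 1"
    using q s by (simp add: d_def)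
  have "D (a - 1) - q * h (a - 1) \<le> D d - q * h d"
  proof (rule DERIV_nonpos_imp_nonincreasing[OF d])
    fix z assume z: "d \<le> z" "z \<le> a - 1"
    have "lam * (z - a) \<le> lam * (- 1)"
      using z lam_pos by (intro mult_left_mono) auto
    then have "1 - exp (lam * (z - a)) - q \<ge> 0"
      by (simp add: q_def)
    then have "deriv h z * (1 - exp (lam * (z - a)) - q) \<le> 0"
      using deriv_h_neg[of z] z by (intro mult_nonpos_nonneg) auto
    moreover have "((\<lambda>x. D x - q * h x) has_real_derivative
        deriv h z * (1 - exp (lam * (z - a)) - q)) (at z)"
      using z by (auto intro!: derivative_eq_intros H_has_derivative h_has_derivative
                       simp: algebra_simps)
    ultimately show "\<exists>r. ((\<lambda>x. D x - q * h x) has_real_derivative r) (at z) \<and> r \<le> 0"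
      by blast
  qed
  moreover have "D (a - 1) > 0"
    using D_decreasing[of "a - 1" a] by simp
  ultimately have "D d \<ge> q * (h d - h (a - 1))"
    by (simp add: algebra_simps)
  moreover have "q * (h d - h (a - 1)) \<ge> q * (s * (a - 1 - d))"
    using h_above_tangent[of "a - 1" d] q by (intro mult_left_mono) (auto simp: s_def algebra_simps)
  moreover have "q * (s * (a - 1 - d)) = \<bar>c\<bar>"
    using q s by (simp add: d_def)
  ultimately show ?thesis
    using d by (intro exI[of _ d]) auto
qed

section \<open>The two turning points\<close>

text \<open>A valley function takes a value twice only on opposite sides of its bottom, and the decrease
  of \<open>D\<close> decides which of the two points is on the left.\<close>
lemma turning_points_separated:
  assumes "H d = H u" "h d > h u"
  shows "d < a" "a < u"
proof -
  have "d < u"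
    using D_decreasing[of u d] assms by (cases d u rule: linorder_cases) auto
  then show "d < a" "a < u"
    using H_increasing[of d u] H_decreasing[of u d] assms(1) by force+
qed

text \<open>Of two nested pairs on levels of \<open>H\<close>, the outer one has the larger cost difference.\<close>
lemma turning_points_unique:
  assumes "H d = H u" "h d - h u = c" "H d' = H u'" "h d' - h u' = c" "c > 0"
  shows "d' = d \<and> u' = u"
proof -
  have inner_d: "d2 \<le> d1"
    if "H d1 = H u1" "h d1 - h u1 = c" "H d2 = H u2" "h d2 - h u2 = c" for d1 u1 d2 u2
  proof (rule ccontr)
    assume "\<not> d2 \<le> d1"
    then have "d1 < d2"
      by simp
    moreover have sep: "d2 < a" "a < u1" "a < u2"
      using turning_points_separated[of d1 u1] turning_points_separated[of d2 u2] that assms(5)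
      by auto
    ultimately have "H u2 < H u1"
      using H_decreasing[of d2 d1] that by simp
    then have "u2 < u1"
      using H_increasing[of u1 u2] sep by (cases u1 u2 rule: linorder_cases) auto
    then show False
      using D_decreasing[OF \<open>d1 < d2\<close>] D_decreasing[of u2 u1] that by linarith
  qed
  have "d' = d"
    using inner_d[of d u d' u'] inner_d[of d' u' d u] assms by force
  moreover have "a < u" "a < u'"
    using turning_points_separated[of d u] turning_points_separated[of d' u'] assms by auto
  then have "u' = u"
    using H_increasing[of u u'] H_increasing[of u' u] assms \<open>d' = d\<close> by force
  ultimately show ?thesis ..
qed

text \<open>Follow the level of \<open>H\<close> at \<open>d\<close> to the right branch with a continuous inverse \<open>G\<close> of \<open>H\<close>. The
  cost difference vanishes at \<open>d = a\<close> and is at least \<open>D d\<close>, so it passes every positive value.\<close>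
lemma turning_points_exist:
  assumes "c > 0"
  shows "\<exists>d u. H d = H u \<and> h d - h u = c"
proof -
  obtain d0 where d0: "d0 < a" "D d0 \<ge> c"
    using D_unbounded_left by blast
  obtain b where b: "a \<le> b" "H b \<ge> H d0"
    using H_unbounded_right by blast
  have inj: "inj_on H {a..b}"
    by (rule linorder_inj_onI) (use H_increasing in force)+
  define G where "G = inv_into {a..b} H"
  have G_H: "G (H x) = x" if "x \<in> {a..b}" for x
    unfolding G_def using inj that by (rule inv_into_f_f)
  have cont_G: "continuous_on (H ` {a..b}) G"
    by (rule continuous_on_inv[OF cont_H compact_Icc]) (use G_H in auto)
  have level: "H d \<in> H ` {a..b}" if "d \<in> {d0..a}" for d
  proof -
    have "H a \<le> H d" "H d \<le> H b"
      using H_decreasing[of a d] H_decreasing[of d d0] that b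
      by (cases "d = a"; cases "d = d0"; simp)+
    then obtain x where "a \<le> x" "x \<le> b" "H x = H d"
      using IVT'[of H a "H d" b] b(1) cont_H by blast
    then show ?thesis
      by (metis atLeastAtMost_iff imageI)
  qed
  have H_G: "G (H d) \<in> {a..b}" "H (G (H d)) = H d" if "d \<in> {d0..a}" for d
    using level[OF that] inv_into_into f_inv_into_f unfolding G_def by metis+
  define F where "F d = h d - h (G (H d))" for d
  have "continuous_on {d0..a} (\<lambda>d. h (G (H d)))"
    by (rule continuous_on_compose2[OF cont_h continuous_on_compose2[OF cont_G cont_H]])
       (use level in auto)
  then have "continuous_on {d0..a} F"
    unfolding F_def[abs_def] by (intro continuous_intros cont_h)
  moreover have "F a = 0"
    using G_H[of a] b(1) by (simp add: F_def)
  moreover have "c \<le> F d0"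
  proof -
    have "D (G (H d0)) \<le> D a"
      using D_decreasing[of a "G (H d0)"] H_G(1)[of d0] d0(1) by (force simp: le_less)
    then have "h (G (H d0)) \<le> H d0"
      using H_G(2)[of d0] d0(1) by simp
    then show ?thesis
      using d0(2) by (simp add: F_def)
  qed
  ultimately obtain d where d: "d \<in> {d0..a}" "F d = c"
    using IVT2'[of F a c d0] assms d0(1) by auto
  show ?thesis
    using H_G(2)[OF d(1)] d(2) unfolding F_def by metis
qed

lemma g_AB_shape:
  assumes mu: "mu > 0" and level: "H d = mu * B" "H u = mu * B" and sep: "d < a" "a < u"
  shows "strict_antimono_on {..<d} (g_AB mu lam a h A B)"
    and "strict_mono_on {d<..<u} (g_AB mu lam a h A B)"
    and "strict_antimono_on {u<..} (g_AB mu lam a h A B)"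
proof -
  let ?g = "g_AB mu lam a h A B"
  let ?g' = "\<lambda>x. lam * exp (- lam * (x - a)) * (B - H x / mu)"
  have g': "(?g has_real_derivative ?g' x) (at x)" for x
    by (rule g_AB_has_derivative[OF cont_h])
  have sign: "?g' x > 0 \<longleftrightarrow> H x < mu * B" "?g' x < 0 \<longleftrightarrow> H x > mu * B" for x
    using lam_pos mu by (auto simp: zero_less_mult_iff mult_less_0_iff field_simps)
  have down: "?g y < ?g x" if "x < y" "\<And>z. x \<le> z \<Longrightarrow> z \<le> y \<Longrightarrow> H z > mu * B" for x y
    using DERIV_neg_imp_decreasing[OF that(1)] that(2) g' sign(2) by meson
  have up: "?g x < ?g y" if "x < y" "\<And>z. x \<le> z \<Longrightarrow> z \<le> y \<Longrightarrow> H z < mu * B" for x y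
    using DERIV_pos_imp_increasing[OF that(1)] that(2) g' sign(1) by meson
  have left: "H z > mu * B" if "z < d" for z
    using H_decreasing[of d z] that sep level by simp
  have right: "H z > mu * B" if "u < z" for z
    using H_increasing[of u z] that sep level by simp
  have mid: "H z < mu * B" if "d < z" "z < u" for z
    using H_decreasing[of z d] H_increasing[of z u] that level by (cases "z \<le> a") auto
  show "strict_antimono_on {..<d} ?g"
    by (rule monotone_onI) (auto intro!: down left)
  show "strict_mono_on {d<..<u} ?g"
    by (rule strict_mono_onI) (auto intro!: up mid)
  show "strict_antimono_on {u<..} ?g"
    by (rule monotone_onI) (auto intro!: down right)
qed

end

section \<open>Existence, uniqueness and shape\<close>

theorem theorem6p2:
  fixes mu sigma k l lam a :: real and h :: "real \<Rightarrow> real"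
  assumes "mu > 0" and "sigma > 0" and "k > 0" and "l > 0"
    and "lam = 2 * mu / sigma\<^sup>2"
    and "holding_cost lam a h"
  shows "\<exists>A B d u.
           boundary_conditions k l (g_AB mu lam a h A B) d u \<and>
           (\<forall>A' B' d' u'. boundary_conditions k l (g_AB mu lam a h A' B') d' u' \<longrightarrow>
              A' = A \<and> B' = B \<and> d' = d \<and> u' = u) \<and>
           d < u \<and>
           strict_antimono_on {..<d} (g_AB mu lam a h A B) \<and>
           strict_mono_on {d<..<u} (g_AB mu lam a h A B) \<and>
           strict_antimono_on {u<..} (g_AB mu lam a h A B)"
proof -
  interpret convex_cost lam a h
    using assms by unfold_locales auto
  have c: "mu * (k + l) > 0"
    using assms by simp
  obtain d u where du: "H d = H u" "h d - h u = mu * (k + l)"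
    using turning_points_exist[OF c] by blast
  have sep: "d < a" "a < u"
    using turning_points_separated[OF du(1)] du(2) c by auto
  define A where "A = h d / mu - k"
  define B where "B = H d / mu"
  have level: "H d = mu * B" "H u = mu * B"
    using du(1) \<open>mu > 0\<close> by (auto simp: B_def)
  note bc = boundary_conditions_iff[OF cont_h lam_pos \<open>mu > 0\<close>]
  show ?thesis
  proof (intro exI conjI allI impI)
    show "boundary_conditions k l (g_AB mu lam a h A B) d u"
      unfolding bc using du by (simp add: A_def B_def)
    show "d < u"
      using sep by simp
  next
    fix A' B' d' u'
    assume "boundary_conditions k l (g_AB mu lam a h A' B') d' u'"
    then have eqs: "H d' = H u'" "h d' - h u' = mu * (k + l)" "B' = H d' / mu" "A' = h d' / mu - k"
      unfolding bc by auto
    then show d': "d' = d" and "u' = u"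
      using turning_points_unique[OF du _ _ c] by auto
    show "A' = A" "B' = B"
      using eqs(3,4) unfolding d' A_def B_def by auto
  qed (use g_AB_shape[OF \<open>mu > 0\<close> level sep] in auto)
qed

end
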